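(* Suppose that: (i) $|f_j(u)-f_j(v)|\le L_j^f|u-v|$ and $|g_j(u)-g_j(v)|\le L_j^g|u-v|$ for all $u,v\in\mathbb R$, $j=1,\dots,m$, with constants $L_j^f,L_j^g>0$; (ii) $|I_{ik}(u)-I_{ik}(v)|\le \ell|u-v|$ for all $u,v\in\mathbb R$, $i=1,\dots,m$, $k\in\mathbb N$, with a constant $\ell>0$; (iii) $\big[(k_1+2k_2)\overline\theta+\ell p\big](1+\ell)^p e^{k_1\overline\theta}<1$; (iv) $k_2\overline\theta+(k_1\overline\theta+\ell p)(1+k_2\overline\theta)(1+\ell)^p e^{k_1\overline\theta}<1$; (v) $\gamma-\mu-\lambda k_2-\dfrac{\ln(1+\ell)}{\underline\tau}>0$. Then the zero solution of the system $$y_i'(t)=-a_iy_i(t)+\sum_{j=1}^m b_{ij}\phi_j(y_j(t))+\sum_{j=1}^m c_{ij}\psi_j(y_j(\beta(t))),\quad t\ne\tau_k,$$ $$\Delta y_i|_{t=\tau_k}=W_{ik}(y_i(\tau_k^-)),\quad i=1,\dots,m,\ k\in\mathbb N,$$ is globally asymptotically stable.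
   Context: $\mathbb N=\{0,1,2,\dots\}$, $\mathbb R^+=[0,\infty)$, $\|u\|=\sum_{i=1}^m|u_i|$ on $\mathbb R^m$. The sequences $\theta=\{\theta_k\}_{k\in\mathbb N}$ (with $\theta_0=0$) and $\tau=\{\tau_k\}_{k\in\mathbb N}$ are real, strictly increasing, tend to $\infty$, and are disjoint: $\tau\cap\theta=\emptyset$. There are positive numbers $\overline\theta,\underline\tau$ with $\theta_{k+1}-\theta_k\le\overline\theta$ and $\underline\tau\le\tau_{k+1}-\tau_k$ for all $k\in\mathbb N$. Let $p_k$ be the number of points of $\tau$ in $(\theta_k,\theta_{k+1})$; it is assumed that $p=\max_{k\in\mathbb N}p_k<\infty$. The function $\beta:\mathbb R^+\to\mathbb R^+$ is defined by $\beta(t)=\theta_k$ for $\theta_k\le t<\theta_{k+1}$. The numbers $a_i>0$ and $b_{ij},c_{ij},d_i\in\mathbb R$ ($i,j=1,\dots,m$) are constants; $f_j,g_j,I_{ik}:\mathbb R\to\mathbb R$. Put $$k_1=\max_{1\le i\le m}\Big(a_i+L_i^f\sum_{j=1}^m|b_{ji}|\Big),\quad k_2=\max_{1\le i\le m}\Big(L_i^g\sum_{j=1}^m|c_{ji}|\Big),\quad \mu=\max_{1\le i\le m}\Big(L_i^f\sum_{j=1}^m|b_{ji}|\Big),\quad \gamma=\min_{1\le i\le m}a_i,$$ $$\lambda=\Big(1-\big(k_2\overline\theta+(k_1\overline\theta+\ell p)(1+k_2\overline\theta)(1+\ell)^p e^{k_1\overline\theta}\big)\Big)^{-1}.$$ The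 point $x^*=(x_1^*,\dots,x_m^* )^T\in\mathbb R^m$ is an equilibrium of the original network, i.e. $0=-a_ix_i^*+\sum_{j}b_{ij}f_j(x_j^* )+\sum_{j}c_{ij}g_j(x_j^* )+d_i$ for all $i$, and $I_{ik}(x_i^* )=0$ for all $i=1,\dots,m$, $k\in\mathbb N$. Define $$\phi_j(u)=f_j(u+x_j^* )-f_j(x_j^* ),\quad \psi_j(u)=g_j(u+x_j^* )-g_j(x_j^* ),\quad W_{ik}(u)=I_{ik}(u+x_i^* )-I_{ik}(x_i^* ).$$ $\Delta y_i|_{t=\tau_k}=y_i(\tau_k)-y_i(\tau_k^-)$, where $y_i(\tau_k^-)$ is the left limit. A solution is a right-continuous function $y$ into $\mathbb R^m$, continuous except possibly at points of $\tau$ where it has discontinuities of the first kind, whose derivative $y'$ is right-continuous and continuous except possibly at points of $\tau\cup\theta$ where it has discontinuities of the first kind (the derivative at such points being the right derivative), and which satisfies the differential equation and the jump conditions. A solution with initial condition $y(t_0)=y_0$, $t_0\ge0$, is understood to be defined on $[\beta(t_0),\infty)$, so that $y(\beta(t))$ makes sense for $t\ge t_0$. Globally asymptotically stable means: for every $t_0\ge 0$, the zero solution is Lyapunov stable (for every $\varepsilon>0$ there is $\delta>0$ such that $\|y(t_0)\|<\delta$ implies $\|y(t)\|<\varepsilon$ for all $t\ge t_0$), and every solution satisfies $\|y(t)\|\to0$ as $t\to\infty$. *)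

theory Defs
  imports "HOL-Analysis.Analysis"
begin

text \<open>The norm on \<open>real ^ 'm\<close> used throughout is the sum norm, not the library's Euclidean \<open>norm\<close>.\<close>

definition norm1 :: "real ^ 'm \<Rightarrow> real" where
  "norm1 u = (\<Sum>i\<in>UNIV. \<bar>u $ i\<bar>)"

text \<open>Meaningful for \<open>t \<ge> \<theta> 0\<close> only, where the index \<open>k\<close> exists and is unique
  if \<open>\<theta>\<close> is strictly increasing and unbounded.\<close>

definition beta :: "(nat \<Rightarrow> real) \<Rightarrow> real \<Rightarrow> real" where
  "beta \<theta> t = \<theta> (THE k. \<theta> k \<le> t \<and> t < \<theta> (Suc k))"

definition num_impulses :: "(nat \<Rightarrow> real) \<Rightarrow> (nat \<Rightarrow> real) \<Rightarrow> nat \<Rightarrow> nat" where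
  "num_impulses \<theta> \<tau> k = card (range \<tau> \<inter> {\<theta> k <..< \<theta> (Suc k)})"

definition left_lim :: "(real \<Rightarrow> 'b::t2_space) \<Rightarrow> real \<Rightarrow> 'b" where
  "left_lim u t = Lim (at_left t) u"

text \<open>On \<open>[s, \<infinity>)\<close>, \<open>u\<close> is right-continuous, and continuous except possibly at points of \<open>D\<close>, where
  discontinuities are of the first kind; values of \<open>u\<close> to the left of \<open>s\<close> play no role.\<close>

definition piecewise_right_continuous ::
    "real \<Rightarrow> real set \<Rightarrow> (real \<Rightarrow> 'b::topological_space) \<Rightarrow> bool" where
  "piecewise_right_continuous s D u \<longleftrightarrow>
     (\<forall>t\<ge>s. (u \<longlongrightarrow> u t) (at_right t)) \<and>
     (\<forall>t>s. t \<notin> D \<longrightarrow> isCont u t) \<and>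
     (\<forall>t>s. t \<in> D \<longrightarrow> (\<exists>l. (u \<longlongrightarrow> l) (at_left t)))"

text \<open>Solutions belonging to an initial time \<open>t0\<close> live on the half-line \<open>[beta \<theta> t0, \<infinity>)\<close>, and satisfy the
  differential equation and the jump conditions on all of it, also to the left of \<open>t0\<close>. The witness
  \<open>y'\<close> is the derivative, one-sided (from the right) at the points of \<open>\<tau>\<close> and \<open>\<theta>\<close>; the point
  \<open>beta \<theta> t0\<close> itself belongs to \<open>\<theta>\<close>.\<close>

definition is_solution ::
    "(nat \<Rightarrow> real) \<Rightarrow> (nat \<Rightarrow> real) \<Rightarrow> ('m \<Rightarrow> real) \<Rightarrow> ('m \<Rightarrow> 'm \<Rightarrow> real) \<Rightarrow> ('m \<Rightarrow> 'm \<Rightarrow> real) \<Rightarrow>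
     ('m \<Rightarrow> real \<Rightarrow> real) \<Rightarrow> ('m \<Rightarrow> real \<Rightarrow> real) \<Rightarrow> ('m \<Rightarrow> nat \<Rightarrow> real \<Rightarrow> real) \<Rightarrow>
     real \<Rightarrow> (real \<Rightarrow> real ^ 'm::finite) \<Rightarrow> bool" where
  "is_solution \<theta> \<tau> a b c \<phi> \<psi> W t0 y \<longleftrightarrow>
     (let s = beta \<theta> t0; D = range \<tau> \<union> range \<theta> in
       piecewise_right_continuous s (range \<tau>) y \<and>
       (\<exists>y'. piecewise_right_continuous s D y' \<and>
             (\<forall>t>s. t \<notin> D \<longrightarrow> (y has_vector_derivative y' t) (at t)) \<and>
             (\<forall>t\<ge>s. t \<in> D \<longrightarrow> (y has_vector_derivative y' t) (at_right t)) \<and>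
             (\<forall>t\<ge>s. t \<notin> range \<tau> \<longrightarrow>
                (\<forall>i. y' t $ i = - a i * y t $ i + (\<Sum>j\<in>UNIV. b i j * \<phi> j (y t $ j))
                                + (\<Sum>j\<in>UNIV. c i j * \<psi> j (y (beta \<theta> t) $ j))))) \<and>
       (\<forall>k. \<tau> k > s \<longrightarrow>
          (\<forall>i. y (\<tau> k) $ i - left_lim y (\<tau> k) $ i = W i k (left_lim y (\<tau> k) $ i))))"

text \<open>\<open>Sol t0\<close> is the set of solutions with initial time \<open>t0\<close>.\<close>

definition zero_globally_asymptotically_stable ::
    "(real \<Rightarrow> (real \<Rightarrow> real ^ 'm) set) \<Rightarrow> bool" where
  "zero_globally_asymptotically_stable Sol \<longleftrightarrow>
     (\<forall>t0\<ge>0.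
        (\<forall>\<epsilon>>0. \<exists>\<delta>>0. \<forall>y\<in>Sol t0. norm1 (y t0) < \<delta> \<longrightarrow> (\<forall>t\<ge>t0. norm1 (y t) < \<epsilon>)) \<and>
        (\<forall>y\<in>Sol t0. ((\<lambda>t. norm1 (y t)) \<longlongrightarrow> 0) at_top))"

lemma beta_eq:
  assumes "strict_mono \<theta>" "\<theta> k \<le> t" "t < \<theta> (Suc k)"
  shows "beta \<theta> t = \<theta> k"
proof -
  have "(THE k. \<theta> k \<le> t \<and> t < \<theta> (Suc k)) = k"
  proof (rule the_equality)
    fix n assume n: "\<theta> n \<le> t \<and> t < \<theta> (Suc n)"
    have "n < Suc k" "k < Suc n"
      using assms n strict_mono_less[OF assms(1)] by (meson le_less_trans)+
    then show "n = k" by simp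
  qed (use assms in auto)
  then show ?thesis by (simp add: beta_def)
qed

lemma zero_is_solution:
  assumes "\<And>j. \<phi> j 0 = 0" "\<And>j. \<psi> j 0 = 0" "\<And>i k. W i k 0 = 0"
  shows "is_solution \<theta> \<tau> a b c \<phi> \<psi> W t0 (\<lambda>_. 0)"
proof -
  have "left_lim (\<lambda>_. 0 :: real ^ 'a) t = 0" for t
    unfolding left_lim_def by (rule tendsto_Lim) auto
  then show ?thesis
    using assms unfolding is_solution_def Let_def piecewise_right_continuous_def
    by (auto intro!: exI[of _ "\<lambda>_. 0"])
qed

end

theory Submission
  imports Defs
begin

text \<open>The sum norm \<open>norm1 (y t)\<close> serves as a Lyapunov function. Away from the impulses its slope to the
  right is at most \<open>- (\<gamma> - \<mu>) * norm1 (y t) + k2 * norm1 (y (beta \<theta> t))\<close>: the self-decay of the neurons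
  contributes \<open>- \<gamma>\<close>, the instantaneous coupling \<open>\<mu>\<close>, the coupling through the delayed state \<open>k2\<close>.

  The delayed state is the obstacle, because it lies in the past. It is removed by showing that the
  trajectory moves little between two switching times. Gronwall's inequality bounds the norm on
  \<open>[\<theta> k, \<theta> (Suc k))\<close> by a multiple of \<open>norm1 (y (\<theta> k))\<close> (\<open>growth_between_switches\<close>); inserted into the
  equation, this bounds \<open>norm1 (y t - y (\<theta> k))\<close> by \<open>\<kappa> * norm1 (y (\<theta> k))\<close>
  (\<open>variation_between_switches\<close>), where \<open>\<kappa> < 1\<close> is the quantity in the smallness assumption \<open>iv\<close>. Hence
  \<open>norm1 (y (beta \<theta> t)) \<le> \<Lambda> * norm1 (y t)\<close> with \<open>\<Lambda> = 1 / (1 - \<kappa>)\<close> (\<open>delayed_state_le\<close>).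

  The norm therefore decays with rate \<open>\<gamma> - \<mu> - \<Lambda> * k2\<close> between impulses, while every impulse multiplies
  it by at most \<open>1 + \<l>\<close>. Impulses are at least \<open>\<tau>low\<close> apart, so on average they cost the rate
  \<open>ln (1 + \<l>) / \<tau>low\<close>, and assumption \<open>v\<close> says that the balance is negative. The result is a uniform
  exponential estimate (\<open>exponential_decay\<close>), stronger than asymptotic stability.

  All estimates rest on one comparison principle for functions with jumps (\<open>impulsive_growth\<close>) and its
  exponentially weighted form (\<open>impulsive_gronwall\<close>).\<close>

section \<open>Differential inequalities for functions with jumps\<close>

text \<open>A bound by \<open>D\<close> on the upper right Dini derivative of \<open>w\<close> at \<open>x\<close>, expressed through a majorant that
  touches \<open>w\<close> at \<open>x\<close> and is differentiable there. In this form the bound inherits the rules of ordinary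
  differentiation, although \<open>w\<close> itself, typically a norm, need not be differentiable.\<close>

definition upper_right_slope :: "(real \<Rightarrow> real) \<Rightarrow> real \<Rightarrow> real \<Rightarrow> bool" where
  "upper_right_slope w x D \<longleftrightarrow>
     (\<exists>h. h x = w x \<and> (h has_real_derivative D) (at_right x) \<and> (\<forall>\<^sub>F z in at_right x. w z \<le> h z))"

lemma upper_right_slope_eventually_less:
  assumes "upper_right_slope w x D" "D < K"
  shows "\<forall>\<^sub>F z in at_right x. w z \<le> w x + K * (z - x)"
proof -
  obtain h where h: "h x = w x" "(h has_real_derivative D) (at_right x)"
      "\<forall>\<^sub>F z in at_right x. w z \<le> h z"
    using assms(1) by (auto simp: upper_right_slope_def)
  have "((\<lambda>z. (h z - h x) / (z - x)) \<longlongrightarrow> D) (at_right x)"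
    using h(2) by (simp add: has_field_derivative_iff)
  then have "\<forall>\<^sub>F z in at_right x. (h z - h x) / (z - x) < K"
    using assms(2) by (rule order_tendstoD(2))
  with h(3) eventually_at_right_less[of x] show ?thesis
  proof eventually_elim
    case (elim z)
    then show ?case using h(1) by (simp add: field_simps)
  qed
qed

lemma upper_right_slope_mult:
  assumes "upper_right_slope w x D" "(E has_real_derivative E') (at x)" "\<And>z. E z \<ge> 0"
  shows "upper_right_slope (\<lambda>z. E z * w z) x (E' * w x + E x * D)"
proof -
  obtain h where h: "h x = w x" "(h has_real_derivative D) (at_right x)"
      "\<forall>\<^sub>F z in at_right x. w z \<le> h z"
    using assms(1) by (auto simp: upper_right_slope_def)
  have "(E has_real_derivative E') (at_right x)"
    using assms(2) by (rule has_field_derivative_at_within)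
  from DERIV_mult[OF this h(2)]
  have "((\<lambda>z. E z * h z) has_real_derivative E' * w x + E x * D) (at_right x)"
    by (simp add: h(1) mult.commute)
  moreover have "\<forall>\<^sub>F z in at_right x. E z * w z \<le> E z * h z"
    using h(3) by eventually_elim (simp add: mult_left_mono assms(3))
  ultimately show ?thesis
    unfolding upper_right_slope_def using h(1) by (intro exI[of _ "\<lambda>z. E z * h z"]) simp
qed

text \<open>If the linear bound of slope \<open>K > C\<close> failed at \<open>t\<close>, there would be a last point up to \<open>t\<close> at which it
  holds; the slope condition there carries it a little further. The slope is demanded only in the open
  interval, so that an impulse may sit at \<open>s\<close>; the bound is first proved from points \<open>x > s\<close> and
  then \<open>x\<close> tends to \<open>s\<close>.\<close>

lemma upper_right_slope_growth:
  fixes w :: "real \<Rightarrow> real"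
  assumes "s \<le> t" and cont: "continuous_on {s..t} w"
    and slope: "\<And>x. s < x \<Longrightarrow> x < t \<Longrightarrow> \<exists>D\<le>C. upper_right_slope w x D"
  shows "w t \<le> w s + C * (t - s)"
proof (cases "s = t")
  case False
  then have "s < t" using assms(1) by simp
  have strict: "w t \<le> w x + K * (t - x)" if x: "s < x" "x < t" and K: "C < K" for x K
  proof -
    define A where "A = {z\<in>{x..t}. w z \<le> w x + K * (z - x)}"
    have cont': "continuous_on {x..t} w"
      using cont by (rule continuous_on_subset) (use x in auto)
    have "closed A"
      unfolding A_def by (intro continuous_on_closed_Collect_le continuous_intros cont' closed_atLeastAtMost)
    moreover have "bounded A"
      by (rule bounded_subset[of "{x..t}"]) (auto simp: A_def)
    moreover have "x \<in> A" using x by (simp add: A_def)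
    ultimately obtain m where m: "m \<in> A" "\<And>z. z \<in> A \<Longrightarrow> z \<le> m"
      using compact_attains_sup[of A] compact_eq_bounded_closed[of A] by blast
    have "m = t"
    proof (rule ccontr)
      assume "m \<noteq> t"
      then have m': "s < m" "m < t" "x \<le> m" using m(1) x by (auto simp: A_def)
      obtain D where "D \<le> C" "upper_right_slope w m D" using slope[OF m'(1,2)] by blast
      then have ev: "\<forall>\<^sub>F z in at_right m. w z \<le> w m + K * (z - m)"
        using upper_right_slope_eventually_less K by fastforce
      have "\<forall>\<^sub>F z in at_right m. m < z \<and> z < t"
        using eventually_at_right_real[OF m'(2)] by simp
      with ev have "\<forall>\<^sub>F z in at_right m. z \<in> A \<and> m < z"
      proof eventually_elim
        case (elim z)
        have "w m \<le> w x + K * (m - x)" using m(1) by (simp add: A_def)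
        with elim(1) have "w z \<le> w x + K * (z - x)" by (simp add: algebra_simps)
        then show ?case using elim m'(3) by (auto simp: A_def)
      qed
      then obtain z where "z \<in> A" "m < z"
        using eventually_happens'[OF trivial_limit_at_right_real] by blast
      then show False using m(2) by fastforce
    qed
    then show ?thesis using m(1) by (simp add: A_def)
  qed
  have le: "w t \<le> w x + C * (t - x)" if x: "s < x" "x < t" for x
  proof (rule field_le_epsilon)
    fix e :: real assume "0 < e"
    then have "w t \<le> w x + (C + e / (t - x)) * (t - x)" using x by (intro strict) auto
    moreover have "(C + e / (t - x)) * (t - x) = C * (t - x) + e"
      using x by (simp add: distrib_right)
    ultimately show "w t \<le> w x + C * (t - x) + e" by simp
  qed
  have lim: "((\<lambda>x. w x + C * (t - x)) \<longlongrightarrow> w s + C * (t - s)) (at_right s)"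
    using continuous_on_Icc_at_rightD[OF cont \<open>s < t\<close>] by (intro tendsto_intros)
  have "\<forall>\<^sub>F x in at_right s. w t \<le> w x + C * (t - x)"
    using eventually_at_right_real[OF \<open>s < t\<close>] by eventually_elim (use le in auto)
  from tendsto_lowerbound[OF lim this] show ?thesis by simp
qed simp

text \<open>Induction over the number of jumps: up to the last jump \<open>u\<close> the induction hypothesis applies and
  passes to the left limit at \<open>u\<close>, and after \<open>u\<close> the function is continuous. Only an upper bound \<open>n\<close> for
  the number of jumps is asked for; as \<open>q \<ge> 1\<close> and all terms are nonnegative, the estimate is monotone
  in \<open>n\<close>.\<close>

lemma impulsive_growth:
  fixes w :: "real \<Rightarrow> real" and q r :: real and n :: nat
  assumes "s \<le> t" and fin: "finite (T \<inter> {s<..t})"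
    and n: "card (T \<inter> {s<..t}) \<le> n"
    and right: "\<And>x. s \<le> x \<Longrightarrow> x < t \<Longrightarrow> (w \<longlongrightarrow> w x) (at_right x)"
    and cont: "\<And>x. s < x \<Longrightarrow> x \<le> t \<Longrightarrow> x \<notin> T \<Longrightarrow> isCont w x"
    and jump: "\<And>x. s < x \<Longrightarrow> x \<le> t \<Longrightarrow> x \<in> T \<Longrightarrow> \<exists>l. (w \<longlongrightarrow> l) (at_left x) \<and> w x \<le> q * l + r"
    and slope: "\<And>x. s < x \<Longrightarrow> x < t \<Longrightarrow> x \<notin> T \<Longrightarrow> \<exists>D\<le>C. upper_right_slope w x D"
    and "w s \<ge> 0" "C \<ge> 0" "q \<ge> 1" "r \<ge> 0"
  shows "w t \<le> q ^ n * (w s + C * (t - s) + n * r)"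
  using \<open>s \<le> t\<close> fin n right cont jump slope
proof (induction n arbitrary: t)
  have segment: "w t \<le> w u + C * (t - u)"
    if u: "s \<le> u" "u \<le> t" and free: "T \<inter> {u<..t} = {}"
      and right: "\<And>x. s \<le> x \<Longrightarrow> x < t \<Longrightarrow> (w \<longlongrightarrow> w x) (at_right x)"
      and cont: "\<And>x. s < x \<Longrightarrow> x \<le> t \<Longrightarrow> x \<notin> T \<Longrightarrow> isCont w x"
      and slope: "\<And>x. s < x \<Longrightarrow> x < t \<Longrightarrow> x \<notin> T \<Longrightarrow> \<exists>D\<le>C. upper_right_slope w x D"
    for u t
  proof (cases "u = t")
    case False
    have "continuous_on {u..t} w"
    proof (rule continuous_on_IccI)
      show "(w \<longlongrightarrow> w u) (at_right u)" using right u False by simp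
      show "w \<midarrow>x\<rightarrow> w x" if "u < x" "x < t" for x
        using cont[of x] that u free by (fastforce simp: isCont_def disjoint_iff)
      have "isCont w t" using cont[of t] u False free by (fastforce simp: disjoint_iff)
      then show "(w \<longlongrightarrow> w t) (at_left t)"
        unfolding isCont_def by (rule filterlim_mono) (auto simp: at_le)
    qed (use u False in simp)
    then show ?thesis
      using u free by (intro upper_right_slope_growth slope) (auto simp: disjoint_iff)
  qed simp
  {
    case 0
    then have "T \<inter> {s<..t} = {}" by simp
    then show ?case using segment[of s t] 0 by simp
  next
    case (Suc n)
    show ?case
    proof (cases "T \<inter> {s<..t} = {}")
      case True
      then have "w t \<le> w s + C * (t - s)" using segment[of s t] Suc by simp
      also have "\<dots> \<le> w s + C * (t - s) + Suc n * r" using \<open>r \<ge> 0\<close> by simp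
      also have "\<dots> \<le> q ^ Suc n * (w s + C * (t - s) + Suc n * r)"
        using mult_right_mono[OF one_le_power[OF \<open>q \<ge> 1\<close>, of "Suc n"],
            of "w s + C * (t - s) + Suc n * r"] assms(8-) Suc.prems(1) by simp
      finally show ?thesis .
    next
      case False
      define u where "u = Max (T \<inter> {s<..t})"
      have u: "u \<in> T" "s < u" "u \<le> t"
        using Max_in[OF Suc.prems(2) False] by (auto simp: u_def)
      have free: "T \<inter> {u<..t} = {}"
      proof (rule ccontr)
        assume "T \<inter> {u<..t} \<noteq> {}"
        then obtain z where "z \<in> T" "u < z" "z \<le> t" by auto
        then have "z \<in> T \<inter> {s<..t}" using u by auto
        then show False using Max_ge[OF Suc.prems(2)] \<open>u < z\<close> by (fastforce simp: u_def)
      qed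
      define B where "B = q ^ n * (w s + C * (u - s) + n * r)"
      have before: "w x \<le> B" if x: "s \<le> x" "x < u" for x
      proof -
        have "T \<inter> {s<..x} \<subseteq> T \<inter> {s<..t}" "u \<in> T \<inter> {s<..t}" "u \<notin> T \<inter> {s<..x}"
          using x u by auto
        then have sub: "T \<inter> {s<..x} \<subset> T \<inter> {s<..t}" by blast
        then have card: "card (T \<inter> {s<..x}) \<le> n"
          using psubset_card_mono[OF Suc.prems(2) sub] Suc.prems(3) by simp
        have "w x \<le> q ^ n * (w s + C * (x - s) + n * r)"
          using x u card finite_subset[OF psubset_imp_subset[OF sub] Suc.prems(2)]
          by (intro Suc.IH Suc.prems(4-)) auto
        also have "\<dots> \<le> B"
          unfolding B_def using x \<open>C \<ge> 0\<close> \<open>q \<ge> 1\<close>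
          by (intro mult_left_mono add_right_mono add_left_mono) auto
        finally show ?thesis .
      qed
      obtain l where l: "(w \<longlongrightarrow> l) (at_left u)" "w u \<le> q * l + r"
        using Suc.prems(6)[OF u(2,3,1)] by blast
      have "\<forall>\<^sub>F x in at_left u. w x \<le> B"
        using eventually_at_left_real[OF u(2)] by eventually_elim (use before in auto)
      then have "l \<le> B" using tendsto_upperbound[OF l(1)] by simp
      have "w t \<le> w u + C * (t - u)"
        using u free by (intro segment Suc.prems) auto
      also have "\<dots> \<le> q * B + (C * (t - u) + r)"
        using l(2) mult_left_mono[OF \<open>l \<le> B\<close>, of q] \<open>q \<ge> 1\<close> by linarith
      also have "\<dots> \<le> q * B + q ^ Suc n * (C * (t - u) + r)"
        using mult_right_mono[OF one_le_power[OF \<open>q \<ge> 1\<close>, of "Suc n"], of "C * (t - u) + r"]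
          \<open>C \<ge> 0\<close> \<open>r \<ge> 0\<close> u(3) by simp
      also have "\<dots> = q ^ Suc n * (w s + C * (t - s) + Suc n * r)"
        by (simp add: B_def algebra_simps)
      finally show ?thesis .
    qed
  }
qed

text \<open>The integrating factor \<open>exp (- K * (x - s))\<close> turns a linear rate \<open>K\<close> into a constant one and commutes
  with the jumps. The forcing has the weight \<open>exp (K * (x - s))\<close>, since this is what the factor cancels;
  for \<open>K \<ge> 0\<close> it dominates the constant forcing \<open>C\<close>.\<close>

lemma impulsive_gronwall:
  fixes w :: "real \<Rightarrow> real" and n :: nat
  assumes "s \<le> t" and fin: "finite (T \<inter> {s<..t})"
    and n: "card (T \<inter> {s<..t}) \<le> n"
    and right: "\<And>x. s \<le> x \<Longrightarrow> x < t \<Longrightarrow> (w \<longlongrightarrow> w x) (at_right x)"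
    and cont: "\<And>x. s < x \<Longrightarrow> x \<le> t \<Longrightarrow> x \<notin> T \<Longrightarrow> isCont w x"
    and jump: "\<And>x. s < x \<Longrightarrow> x \<le> t \<Longrightarrow> x \<in> T \<Longrightarrow> \<exists>l. (w \<longlongrightarrow> l) (at_left x) \<and> w x \<le> q * l"
    and slope: "\<And>x. s < x \<Longrightarrow> x < t \<Longrightarrow> x \<notin> T \<Longrightarrow>
                  \<exists>D\<le>K * w x + C * exp (K * (x - s)). upper_right_slope w x D"
    and "w s \<ge> 0" "C \<ge> 0" "q \<ge> 1"
  shows "w t \<le> exp (K * (t - s)) * q ^ n * (w s + C * (t - s))"
proof -
  define E where "E = (\<lambda>x. exp (- K * (x - s)))"
  have E: "(E has_real_derivative - K * E x) (at x)" for x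
    unfolding E_def by (auto intro!: derivative_eq_intros)
  have E_cont: "isCont E x" for x using E by (rule DERIV_isCont)
  have E_nonneg: "0 \<le> E x" for x by (simp add: E_def)
  have E_lim: "(E \<longlongrightarrow> E x) (at x within S)" for x S
    using E_cont[of x] continuous_within by (metis continuous_at_imp_continuous_within)
  have E_inv: "E x * exp (K * (x - s)) = 1" for x
    by (simp add: E_def flip: exp_add)
  have "E t * w t \<le> q ^ n * (E s * w s + C * (t - s) + n * (0::real))"
  proof (rule impulsive_growth[OF \<open>s \<le> t\<close> fin n])
    fix x assume x: "s < x" "x \<le> t" "x \<in> T"
    obtain l where "(w \<longlongrightarrow> l) (at_left x)" "w x \<le> q * l" using jump[OF x] by blast
    then have "((\<lambda>x. E x * w x) \<longlongrightarrow> E x * l) (at_left x)" "E x * w x \<le> q * (E x * l) + 0"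
      using mult_left_mono[of "w x" "q * l" "E x"] E_nonneg[of x] tendsto_mult[OF E_lim]
      by (simp_all add: mult.left_commute)
    then show "\<exists>l. ((\<lambda>x. E x * w x) \<longlongrightarrow> l) (at_left x) \<and> E x * w x \<le> q * l + 0" by blast
  next
    fix x assume x: "s < x" "x < t" "x \<notin> T"
    obtain D where D: "D \<le> K * w x + C * exp (K * (x - s))" "upper_right_slope w x D"
      using slope[OF x] by blast
    have "upper_right_slope (\<lambda>x. E x * w x) x (- K * E x * w x + E x * D)"
      using D(2) E by (rule upper_right_slope_mult) (simp add: E_def)
    moreover have "E x * D \<le> E x * (K * w x + C * exp (K * (x - s)))"
      using D(1) by (intro mult_left_mono) (simp_all add: E_def)
    then have "- K * E x * w x + E x * D \<le> C"
      using E_inv[of x] by (simp add: algebra_simps)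
    ultimately show "\<exists>D\<le>C. upper_right_slope (\<lambda>x. E x * w x) x D" by blast
  qed (use right cont assms(8-) in \<open>auto intro!: tendsto_mult E_lim continuous_intros E_cont mult_nonneg_nonneg E_nonneg\<close>)
  then have "E t * w t \<le> q ^ n * (w s + C * (t - s))" by (simp add: E_def)
  then have "exp (K * (t - s)) * (E t * w t) \<le> exp (K * (t - s)) * (q ^ n * (w s + C * (t - s)))"
    by (rule mult_left_mono) simp
  moreover have "exp (K * (t - s)) * (E t * w t) = w t"
    using E_inv[of t] by (metis mult.assoc mult.commute mult_1)
  ultimately show ?thesis by (simp add: mult.assoc)
qed

section \<open>The sum norm along a trajectory\<close>

lemma norm1_nonneg: "norm1 u \<ge> 0"
  by (simp add: norm1_def sum_nonneg)

lemma norm1_triangle: "norm1 (u + v) \<le> norm1 u + norm1 v"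
  unfolding norm1_def sum.distrib[symmetric] by (intro sum_mono) (simp add: abs_triangle_ineq)

lemma tendsto_norm1: "(y \<longlongrightarrow> l) F \<Longrightarrow> ((\<lambda>t. norm1 (y t)) \<longlongrightarrow> norm1 l) F"
  unfolding norm1_def by (intro tendsto_intros)

text \<open>Splitting the velocity as \<open>y' i = - \<alpha> i * y i + r i\<close> keeps the damping term with its sign: for
  \<open>z\<close> close to \<open>x\<close> the factor \<open>1 - \<alpha> i * (z - x)\<close> is positive, so \<open>y i\<close> at \<open>z\<close> is the shrunk value
  \<open>(1 - \<alpha> i * (z - x)) * y x i\<close> plus an error \<open>u i z\<close> that vanishes at \<open>x\<close> and has derivative \<open>r i\<close>.
  The choice \<open>\<alpha> = 0\<close> gives the crude bound of the slope by the sum norm of the velocity.\<close>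

lemma upper_right_slope_norm1:
  fixes y :: "real \<Rightarrow> real ^ 'm::finite"
  assumes y: "(y has_vector_derivative y') (at_right x)"
  shows "upper_right_slope (\<lambda>t. norm1 (y t)) x
           (\<Sum>i\<in>UNIV. - \<alpha> i * \<bar>y x $ i\<bar> + \<bar>y' $ i + \<alpha> i * y x $ i\<bar>)"
proof -
  define u where "u = (\<lambda>i z. y z $ i - (1 - \<alpha> i * (z - x)) * y x $ i)"
  define h where "h = (\<lambda>z. \<Sum>i\<in>UNIV. (1 - \<alpha> i * (z - x)) * \<bar>y x $ i\<bar> + \<bar>u i z\<bar>)"
  have comp: "((\<lambda>z. y z $ i) has_real_derivative y' $ i) (at_right x)" for i
    using bounded_linear.has_vector_derivative[OF bounded_linear_vec_nth[of i] y]
    by (simp add: has_real_derivative_iff_has_vector_derivative)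
  have u: "(u i has_real_derivative y' $ i + \<alpha> i * y x $ i) (at_right x)" for i
    unfolding u_def by (rule DERIV_cong[OF DERIV_diff[OF comp DERIV_cmult_right[OF
      DERIV_diff[OF DERIV_const DERIV_cmult[OF DERIV_diff[OF DERIV_ident DERIV_const]]]]]]) simp
  have abs_u: "((\<lambda>z. \<bar>u i z\<bar>) has_real_derivative \<bar>y' $ i + \<alpha> i * y x $ i\<bar>) (at_right x)" for i
  proof -
    have u0: "u i x = 0" by (simp add: u_def)
    have "((\<lambda>z. \<bar>(u i z - u i x) / (z - x)\<bar>) \<longlongrightarrow> \<bar>y' $ i + \<alpha> i * y x $ i\<bar>) (at_right x)"
      using u[of i] by (intro tendsto_rabs) (simp add: has_field_derivative_iff)
    moreover have "\<forall>\<^sub>F z in at_right x. \<bar>(u i z - u i x) / (z - x)\<bar> = (\<bar>u i z\<bar> - \<bar>u i x\<bar>) / (z - x)"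
      using eventually_at_right_less[of x] by eventually_elim (simp add: u0 abs_divide)
    ultimately show ?thesis
      unfolding has_field_derivative_iff by (rule Lim_transform_eventually)
  qed
  have "h x = norm1 (y x)" by (simp add: h_def norm1_def u_def)
  moreover have "(h has_real_derivative
      (\<Sum>i\<in>UNIV. - \<alpha> i * \<bar>y x $ i\<bar> + \<bar>y' $ i + \<alpha> i * y x $ i\<bar>)) (at_right x)"
    unfolding h_def by (intro DERIV_sum DERIV_add abs_u) (auto intro!: derivative_eq_intros)
  moreover have "\<forall>\<^sub>F z in at_right x. norm1 (y z) \<le> h z"
  proof -
    have "\<forall>\<^sub>F z in at_right x. \<forall>i. 0 < 1 - \<alpha> i * (z - x)"
    proof (rule eventually_all_finite)
      fix i
      have "((\<lambda>z. 1 - \<alpha> i * (z - x)) \<longlongrightarrow> 1 - \<alpha> i * (x - x)) (at_right x)"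
        by (intro tendsto_intros)
      then show "\<forall>\<^sub>F z in at_right x. 0 < 1 - \<alpha> i * (z - x)"
        by (rule order_tendstoD) simp
    qed
    then show ?thesis
    proof eventually_elim
      case (elim z)
      have "\<bar>y z $ i\<bar> \<le> (1 - \<alpha> i * (z - x)) * \<bar>y x $ i\<bar> + \<bar>u i z\<bar>" for i
      proof -
        have "\<bar>y z $ i\<bar> = \<bar>(1 - \<alpha> i * (z - x)) * y x $ i + u i z\<bar>" by (simp add: u_def)
        also have "\<dots> \<le> \<bar>(1 - \<alpha> i * (z - x)) * y x $ i\<bar> + \<bar>u i z\<bar>" by (rule abs_triangle_ineq)
        finally show ?thesis using elim[rule_format, of i] by (simp add: abs_mult)
      qed
      then show ?case unfolding norm1_def h_def by (intro sum_mono)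
    qed
  qed
  ultimately show ?thesis unfolding upper_right_slope_def by blast
qed

text \<open>Exchanging the two summations collects everything that neuron \<open>i\<close> sends out, which is why the
  column sums of the connection matrix, and not its row sums, enter the stability criterion.\<close>

lemma sum_abs_coupling_le:
  fixes B :: "'m::finite \<Rightarrow> 'm \<Rightarrow> real" and u :: "real ^ 'm"
  assumes h: "\<And>j r. \<bar>h j r\<bar> \<le> L j * \<bar>r\<bar>"
  shows "(\<Sum>i\<in>UNIV. \<bar>\<Sum>j\<in>UNIV. B i j * h j (u $ j)\<bar>)
           \<le> (\<Sum>i\<in>UNIV. (L i * (\<Sum>j\<in>UNIV. \<bar>B j i\<bar>)) * \<bar>u $ i\<bar>)"
proof -
  have "(\<Sum>i\<in>UNIV. \<bar>\<Sum>j\<in>UNIV. B i j * h j (u $ j)\<bar>)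
          \<le> (\<Sum>i\<in>UNIV. \<Sum>j\<in>UNIV. \<bar>B i j\<bar> * (L j * \<bar>u $ j\<bar>))"
    by (intro sum_mono order_trans[OF sum_abs]) (auto simp: abs_mult intro!: mult_left_mono h)
  also have "\<dots> = (\<Sum>j\<in>UNIV. \<Sum>i\<in>UNIV. \<bar>B i j\<bar> * (L j * \<bar>u $ j\<bar>))"
    by (rule sum.swap)
  also have "\<dots> = (\<Sum>i\<in>UNIV. (L i * (\<Sum>j\<in>UNIV. \<bar>B j i\<bar>)) * \<bar>u $ i\<bar>)"
    by (simp add: sum_distrib_left sum_distrib_right mult_ac)
  finally show ?thesis .
qed

lemma sum_weighted_abs_le:
  fixes u :: "real ^ 'm::finite"
  assumes "\<And>i. \<kappa> i \<le> K"
  shows "(\<Sum>i\<in>UNIV. \<kappa> i * \<bar>u $ i\<bar>) \<le> K * norm1 u"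
  unfolding norm1_def sum_distrib_left by (intro sum_mono mult_right_mono assms) simp

section \<open>Switching and impulse times\<close>

lemma beta_interval:
  fixes \<theta> :: "nat \<Rightarrow> real"
  assumes "strict_mono \<theta>" "filterlim \<theta> at_top sequentially" "\<theta> 0 \<le> t"
  obtains k where "\<theta> k \<le> t" "t < \<theta> (Suc k)" "beta \<theta> t = \<theta> k"
proof -
  have ex: "\<exists>n. t < \<theta> n"
    using assms(2) unfolding filterlim_at_top_dense eventually_sequentially by blast
  define n where "n = (LEAST n. t < \<theta> n)"
  have n: "t < \<theta> n" "\<And>j. j < n \<Longrightarrow> \<not> t < \<theta> j"
    unfolding n_def using LeastI_ex[OF ex] not_less_Least by blast+
  then have "n \<noteq> 0" using assms(3) by (cases n) auto
  then obtain k where "n = Suc k" using not0_implies_Suc by blast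
  with n have "\<theta> k \<le> t" "t < \<theta> (Suc k)" by (auto simp: not_less)
  then show ?thesis using that beta_eq[OF assms(1)] by blast
qed

lemma beta_mono:
  fixes \<theta> :: "nat \<Rightarrow> real"
  assumes "strict_mono \<theta>" "filterlim \<theta> at_top sequentially" "\<theta> 0 \<le> t" "t \<le> t'"
  shows "beta \<theta> t \<le> beta \<theta> t'"
proof -
  obtain k where k: "\<theta> k \<le> t" "beta \<theta> t = \<theta> k"
    using beta_interval[OF assms(1-3)] by blast
  obtain k' where k': "t' < \<theta> (Suc k')" "beta \<theta> t' = \<theta> k'"
    using beta_interval[OF assms(1,2), of t'] assms(3,4) by (metis order_trans)
  have "\<theta> k < \<theta> (Suc k')" using k k' assms(4) by linarith
  then have "k \<le> k'" using strict_mono_less[OF assms(1)] by simp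
  then show ?thesis using k k' strict_mono_less_eq[OF assms(1)] by simp
qed

lemma finite_range_atMost:
  fixes \<tau> :: "nat \<Rightarrow> real"
  assumes "filterlim \<tau> at_top sequentially"
  shows "finite (range \<tau> \<inter> {..t})"
proof -
  obtain N where N: "\<And>n. n \<ge> N \<Longrightarrow> t < \<tau> n"
    using assms unfolding filterlim_at_top_dense eventually_sequentially by blast
  have "range \<tau> \<inter> {..t} \<subseteq> \<tau> ` {..<N}" 
  proof (intro subsetI, elim IntE imageE)
    fix x n assume "x = \<tau> n" "x \<in> {..t}"
    then show "x \<in> \<tau> ` {..<N}" using N[of n] by (cases "N \<le> n") auto
  qed
  then show ?thesis by (rule finite_subset) simp
qed

text \<open>A set of \<open>n\<close> points with gaps at least \<open>\<tau>low\<close> spans a length of at least \<open>(n - 1) * \<tau>low\<close>.\<close>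

lemma card_separated_le:
  fixes \<tau> :: "nat \<Rightarrow> real"
  assumes mono: "strict_mono \<tau>" and lim: "filterlim \<tau> at_top sequentially"
    and low: "\<tau>low > 0" "\<And>k. \<tau>low \<le> \<tau> (Suc k) - \<tau> k" and "s \<le> t"
  shows "real (card (range \<tau> \<inter> {s<..t})) \<le> (t - s) / \<tau>low + 1"
proof (cases "range \<tau> \<inter> {s<..t} = {}")
  case True
  then show ?thesis using low(1) \<open>s \<le> t\<close> by simp
next
  case False
  define K where "K = {k. s < \<tau> k \<and> \<tau> k \<le> t}"
  have img: "range \<tau> \<inter> {s<..t} = \<tau> ` K" by (auto simp: K_def)
  have inj: "inj_on \<tau> K" using mono strict_mono_imp_inj_on by blast
  have "finite (\<tau> ` K)"
    using finite_range_atMost[OF lim, of t] unfolding img[symmetric]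
    by (rule finite_subset[rotated]) auto
  then have fin: "finite K" using inj by (simp add: finite_image_iff)
  have ne: "K \<noteq> {}" using False img by auto
  define i where "i = Min K"
  define j where "j = Max K"
  have ij: "i \<in> K" "j \<in> K" "K \<subseteq> {i..j}"
    using fin ne by (auto simp: i_def j_def)
  have step: "real n * \<tau>low \<le> \<tau> (i + n) - \<tau> i" for n
  proof (induction n)
    case (Suc n)
    then show ?case using low(2)[of "i + n"] by (simp add: algebra_simps)
  qed simp
  have "i \<le> j" using ij by auto
  have "real (j - i) * \<tau>low \<le> t - s"
    using step[of "j - i"] ij(1,2) \<open>i \<le> j\<close> by (auto simp: K_def)
  then have "real (j - i) \<le> (t - s) / \<tau>low" using low(1) by (simp add: field_simps)
  moreover have "card K \<le> j - i + 1"
    using card_mono[OF _ ij(3)] \<open>i \<le> j\<close> by simp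
  ultimately show ?thesis by (simp add: img card_image[OF inj])
qed

section \<open>Trajectories of the network\<close>

text \<open>The maxima and minima of the criterion enter only as bounds, and the activations and impulse
  functions only through their linear growth at \<open>0\<close>.\<close>

locale impulsive_network =
  fixes \<theta> \<tau> :: "nat \<Rightarrow> real"
    and \<theta>bar \<tau>low :: real
    and p :: nat
    and a Lf Lg :: "'m::finite \<Rightarrow> real"
    and b c :: "'m \<Rightarrow> 'm \<Rightarrow> real"
    and \<phi> \<psi> :: "'m \<Rightarrow> real \<Rightarrow> real"
    and W :: "'m \<Rightarrow> nat \<Rightarrow> real \<Rightarrow> real"
    and \<l> k1 k2 \<mu> \<gamma> :: real
  assumes theta: "\<theta> 0 = 0" "strict_mono \<theta>" "filterlim \<theta> at_top sequentially"
    and theta_gap: "\<And>k. \<theta> (Suc k) - \<theta> k \<le> \<theta>bar"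
    and tau: "strict_mono \<tau>" "filterlim \<tau> at_top sequentially"
    and tau_gap: "\<tau>low > 0" "\<And>k. \<tau>low \<le> \<tau> (Suc k) - \<tau> k"
    and impulses_le: "\<And>k. num_impulses \<theta> \<tau> k \<le> p"
    and phi_le: "\<And>j u. \<bar>\<phi> j u\<bar> \<le> Lf j * \<bar>u\<bar>"
    and psi_le: "\<And>j u. \<bar>\<psi> j u\<bar> \<le> Lg j * \<bar>u\<bar>"
    and W_le: "\<And>i k u. \<bar>W i k u\<bar> \<le> \<l> * \<bar>u\<bar>"
    and l_nonneg: "\<l> \<ge> 0"
    and a_pos: "\<And>i. a i > 0"
    and k1: "\<And>i. a i + Lf i * (\<Sum>j\<in>UNIV. \<bar>b j i\<bar>) \<le> k1" "k1 \<ge> 0"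
    and k2: "\<And>i. Lg i * (\<Sum>j\<in>UNIV. \<bar>c j i\<bar>) \<le> k2" "k2 \<ge> 0"
    and mu: "\<And>i. Lf i * (\<Sum>j\<in>UNIV. \<bar>b j i\<bar>) \<le> \<mu>"
    and gamma: "\<And>i. \<gamma> \<le> a i"
begin

lemma finite_impulses: "finite (range \<tau> \<inter> {s<..t})"
  using finite_range_atMost[OF tau(2), of t] by (rule finite_subset[rotated]) auto

lemma card_impulses_le:
  assumes "t < \<theta> (Suc k)"
  shows "card (range \<tau> \<inter> {\<theta> k<..t}) \<le> p"
proof -
  have "finite (range \<tau> \<inter> {\<theta> k<..<\<theta> (Suc k)})"
    using finite_impulses[of "\<theta> k" "\<theta> (Suc k)"] by (rule finite_subset[rotated]) auto
  then have "card (range \<tau> \<inter> {\<theta> k<..t}) \<le> num_impulses \<theta> \<tau> k"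
    unfolding num_impulses_def using assms by (intro card_mono) auto
  then show ?thesis using impulses_le order_trans by blast
qed

definition velocity :: "real ^ 'm \<Rightarrow> real ^ 'm \<Rightarrow> real ^ 'm" where
  "velocity u v = (\<chi> i. - a i * u $ i + (\<Sum>j\<in>UNIV. b i j * \<phi> j (u $ j))
                             + (\<Sum>j\<in>UNIV. c i j * \<psi> j (v $ j)))"

lemma velocity_nth:
  "velocity u v $ i = - a i * u $ i + (\<Sum>j\<in>UNIV. b i j * \<phi> j (u $ j))
                        + (\<Sum>j\<in>UNIV. c i j * \<psi> j (v $ j))"
  by (simp add: velocity_def)

lemma coupling_phi_le:
  "(\<Sum>i\<in>UNIV. \<bar>\<Sum>j\<in>UNIV. b i j * \<phi> j (u $ j)\<bar>) \<le> (\<Sum>i\<in>UNIV. (Lf i * (\<Sum>j\<in>UNIV. \<bar>b j i\<bar>)) * \<bar>u $ i\<bar>)"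
  using phi_le by (rule sum_abs_coupling_le)

lemma coupling_psi_le:
  "(\<Sum>i\<in>UNIV. \<bar>\<Sum>j\<in>UNIV. c i j * \<psi> j (v $ j)\<bar>) \<le> k2 * norm1 v"
  by (rule order_trans[OF sum_abs_coupling_le[OF psi_le] sum_weighted_abs_le]) (rule k2(1))

text \<open>The crude estimate: damping and coupling are added up regardless of sign.\<close>

lemma norm1_velocity_le: "norm1 (velocity u v) \<le> k1 * norm1 u + k2 * norm1 v"
proof -
  have "norm1 (velocity u v) \<le> (\<Sum>i\<in>UNIV. a i * \<bar>u $ i\<bar> + \<bar>\<Sum>j\<in>UNIV. b i j * \<phi> j (u $ j)\<bar>
      + \<bar>\<Sum>j\<in>UNIV. c i j * \<psi> j (v $ j)\<bar>)"
    unfolding norm1_def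
  proof (rule sum_mono)
    fix i
    have "\<bar>a i * u $ i\<bar> = a i * \<bar>u $ i\<bar>" using a_pos[of i] by (simp add: abs_mult)
    then show "\<bar>velocity u v $ i\<bar> \<le> a i * \<bar>u $ i\<bar> + \<bar>\<Sum>j\<in>UNIV. b i j * \<phi> j (u $ j)\<bar>
      + \<bar>\<Sum>j\<in>UNIV. c i j * \<psi> j (v $ j)\<bar>" by (simp add: velocity_nth)
  qed
  also have "\<dots> \<le> (\<Sum>i\<in>UNIV. (a i + Lf i * (\<Sum>j\<in>UNIV. \<bar>b j i\<bar>)) * \<bar>u $ i\<bar>) + k2 * norm1 v"
    using coupling_phi_le[of u] coupling_psi_le[of v] by (simp add: sum.distrib distrib_right)
  also have "(\<Sum>i\<in>UNIV. (a i + Lf i * (\<Sum>j\<in>UNIV. \<bar>b j i\<bar>)) * \<bar>u $ i\<bar>) \<le> k1 * norm1 u"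
    by (rule sum_weighted_abs_le) (rule k1(1))
  finally show ?thesis by simp
qed

text \<open>The signed estimate: the left-hand side is the slope of the sum norm for the choice \<open>\<alpha> = a\<close>, and
  the decay rates \<open>a i\<close> compete only with the couplings.\<close>

lemma dissipation_le:
  "(\<Sum>i\<in>UNIV. - a i * \<bar>u $ i\<bar> + \<bar>velocity u v $ i + a i * u $ i\<bar>) \<le> - (\<gamma> - \<mu>) * norm1 u + k2 * norm1 v"
proof -
  have "(\<Sum>i\<in>UNIV. - a i * \<bar>u $ i\<bar> + \<bar>velocity u v $ i + a i * u $ i\<bar>)
      \<le> (\<Sum>i\<in>UNIV. - a i * \<bar>u $ i\<bar> + \<bar>\<Sum>j\<in>UNIV. b i j * \<phi> j (u $ j)\<bar>
      + \<bar>\<Sum>j\<in>UNIV. c i j * \<psi> j (v $ j)\<bar>)"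
    by (intro sum_mono) (simp add: velocity_nth)
  also have "\<dots> \<le> (\<Sum>i\<in>UNIV. - a i * \<bar>u $ i\<bar>) + (\<Sum>i\<in>UNIV. (Lf i * (\<Sum>j\<in>UNIV. \<bar>b j i\<bar>)) * \<bar>u $ i\<bar>)
      + k2 * norm1 v"
    using coupling_phi_le[of u] coupling_psi_le[of v]
    by (simp add: sum.distrib sum_subtractf sum_negf)
  also have "\<dots> \<le> - \<gamma> * norm1 u + \<mu> * norm1 u + k2 * norm1 v"
    by (intro add_mono order_refl sum_weighted_abs_le le_imp_neg_le gamma mu)
  finally show ?thesis by (simp add: algebra_simps)
qed

end

locale impulsive_trajectory = impulsive_network +
  fixes t0 :: real and y :: "real \<Rightarrow> real ^ 'a"
  assumes t0: "t0 \<ge> 0" and sol: "is_solution \<theta> \<tau> a b c \<phi> \<psi> W t0 y"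
begin

lemma right_continuous: "beta \<theta> t0 \<le> t \<Longrightarrow> (y \<longlongrightarrow> y t) (at_right t)"
  using sol by (simp add: is_solution_def Let_def piecewise_right_continuous_def)

lemma continuous_off_impulses: "beta \<theta> t0 < t \<Longrightarrow> t \<notin> range \<tau> \<Longrightarrow> isCont y t"
  using sol by (simp add: is_solution_def Let_def piecewise_right_continuous_def)

lemma jump_le:
  assumes t: "beta \<theta> t0 < t" "t \<in> range \<tau>"
  obtains l where "(y \<longlongrightarrow> l) (at_left t)" "norm1 (y t - l) \<le> \<l> * norm1 l"
proof -
  obtain k where k: "t = \<tau> k" using t(2) by blast
  obtain l where l: "(y \<longlongrightarrow> l) (at_left t)"
    using sol t by (auto simp: is_solution_def Let_def piecewise_right_continuous_def)
  have "left_lim y t = l"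
    unfolding left_lim_def using l by (intro tendsto_Lim) simp_all
  moreover have "\<forall>i. y t $ i - left_lim y t $ i = W i k (left_lim y t $ i)"
    using sol t(1) by (simp add: is_solution_def Let_def k)
  ultimately have "norm1 (y t - l) \<le> \<l> * norm1 l"
    unfolding norm1_def sum_distrib_left by (intro sum_mono) (simp add: W_le)
  with l that show ?thesis by blast
qed

lemma right_derivative:
  assumes "beta \<theta> t0 < t" "t \<notin> range \<tau>"
  shows "(y has_vector_derivative velocity (y t) (y (beta \<theta> t))) (at_right t)"
proof -
  obtain y' where y': "\<forall>t>beta \<theta> t0. t \<notin> range \<tau> \<union> range \<theta> \<longrightarrow> (y has_vector_derivative y' t) (at t)"
     "\<forall>t\<ge>beta \<theta> t0. t \<in> range \<tau> \<union> range \<theta> \<longrightarrow> (y has_vector_derivative y' t) (at_right t)"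
     "\<forall>t\<ge>beta \<theta> t0. t \<notin> range \<tau> \<longrightarrow>
        (\<forall>i. y' t $ i = - a i * y t $ i + (\<Sum>j\<in>UNIV. b i j * \<phi> j (y t $ j))
                                + (\<Sum>j\<in>UNIV. c i j * \<psi> j (y (beta \<theta> t) $ j)))"
    using sol unfolding is_solution_def Let_def by blast
  have "y' t = velocity (y t) (y (beta \<theta> t))"
    using y'(3) assms by (simp add: vec_eq_iff velocity_nth)
  moreover have "(y has_vector_derivative y' t) (at_right t)"
    using y'(1,2) assms has_vector_derivative_at_within[of y "y' t" t "{t<..}"]
    by (cases "t \<in> range \<theta>") auto
  ultimately show ?thesis by simp
qed

lemma norm1_right_continuous:
  "beta \<theta> t0 \<le> t \<Longrightarrow> ((\<lambda>t. norm1 (y t - v)) \<longlongrightarrow> norm1 (y t - v)) (at_right t)"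
  by (intro tendsto_norm1 tendsto_diff tendsto_const right_continuous)

lemma norm1_continuous_off_impulses:
  "beta \<theta> t0 < t \<Longrightarrow> t \<notin> range \<tau> \<Longrightarrow> isCont (\<lambda>t. norm1 (y t - v)) t"
  unfolding isCont_def
  by (intro tendsto_norm1 tendsto_diff tendsto_const isContD continuous_off_impulses)

lemma norm1_jump_le:
  assumes "beta \<theta> t0 < t" "t \<in> range \<tau>"
  shows "\<exists>l. ((\<lambda>t. norm1 (y t)) \<longlongrightarrow> l) (at_left t) \<and> norm1 (y t) \<le> (1 + \<l>) * l"
proof -
  obtain l where l: "(y \<longlongrightarrow> l) (at_left t)" "norm1 (y t - l) \<le> \<l> * norm1 l"
    using jump_le[OF assms] by blast
  have "norm1 (y t) \<le> norm1 (y t - l) + norm1 l" using norm1_triangle[of "y t - l" l] by simp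
  also have "\<dots> \<le> (1 + \<l>) * norm1 l" using l(2) by (simp add: algebra_simps)
  finally show ?thesis using tendsto_norm1[OF l(1)] by blast
qed

text \<open>Between two switching times the delayed argument is the constant state \<open>y (\<theta> k)\<close>, so the norm
  obeys a linear inequality with a constant forcing of size \<open>k2 * norm1 (y (\<theta> k))\<close>, and at most \<open>p\<close>
  impulses magnify it by \<open>1 + \<l>\<close> each.\<close>

lemma growth_between_switches:
  assumes start: "beta \<theta> t0 \<le> \<theta> k" and t: "\<theta> k \<le> t" "t < \<theta> (Suc k)"
  shows "norm1 (y t) \<le> (1 + k2 * \<theta>bar) * (1 + \<l>) ^ p * exp (k1 * \<theta>bar) * norm1 (y (\<theta> k))"
proof -
  let ?v = "norm1 (y (\<theta> k))"
  have len: "t - \<theta> k \<le> \<theta>bar" using t theta_gap[of k] by linarith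
  have "norm1 (y t) \<le> exp (k1 * (t - \<theta> k)) * (1 + \<l>) ^ p * (?v + k2 * ?v * (t - \<theta> k))"
  proof (rule impulsive_gronwall[OF t(1) finite_impulses card_impulses_le[OF t(2)]])
    fix x assume x: "\<theta> k < x" "x < t" "x \<notin> range \<tau>"
    let ?F = "velocity (y x) (y (beta \<theta> x))"
    have "beta \<theta> x = \<theta> k" using x t by (intro beta_eq theta) auto
    then have "norm1 ?F \<le> k1 * norm1 (y x) + k2 * ?v" 
      using norm1_velocity_le[of "y x" "y (beta \<theta> x)"] by simp
    also have "\<dots> \<le> k1 * norm1 (y x) + k2 * ?v * exp (k1 * (x - \<theta> k))"
      using mult_left_mono[of 1 "exp (k1 * (x - \<theta> k))" "k2 * ?v"] x k1(2)
        mult_nonneg_nonneg[OF k2(2) norm1_nonneg[of "y (\<theta> k)"]] by simp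
    finally have "norm1 ?F \<le> \<dots>" .
    moreover have "upper_right_slope (\<lambda>t. norm1 (y t)) x (norm1 ?F)"
      using upper_right_slope_norm1[OF right_derivative[of x], of "\<lambda>_. 0"] x start
      by (simp add: norm1_def)
    ultimately show "\<exists>D\<le>k1 * norm1 (y x) + k2 * ?v * exp (k1 * (x - \<theta> k)).
        upper_right_slope (\<lambda>t. norm1 (y t)) x D" by blast
  next
    show "0 \<le> norm1 (y (\<theta> k))" "0 \<le> k2 * ?v" using k2(2) norm1_nonneg[of "y (\<theta> k)"] by simp_all
  qed (use start l_nonneg norm1_right_continuous[of _ 0] norm1_continuous_off_impulses[of _ 0]
         norm1_jump_le in simp_all)
  also have "\<dots> \<le> exp (k1 * \<theta>bar) * (1 + \<l>) ^ p * (?v + k2 * ?v * \<theta>bar)"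
  proof (intro mult_mono add_left_mono mult_left_mono)
    show "exp (k1 * (t - \<theta> k)) \<le> exp (k1 * \<theta>bar)"
      using mult_left_mono[OF len k1(2)] by simp
    have "0 \<le> k2 * ?v" using k2(2) norm1_nonneg by (rule mult_nonneg_nonneg)
    then show "0 \<le> ?v + k2 * ?v * (t - \<theta> k)"
      using t(1) norm1_nonneg[of "y (\<theta> k)"] by simp
  qed (use len t(1) l_nonneg k2(2) in \<open>simp_all add: norm1_nonneg\<close>)
  also have "?v + k2 * ?v * \<theta>bar = (1 + k2 * \<theta>bar) * ?v" by (simp add: distrib_right)
  finally show ?thesis by (simp only: mult_ac)
qed

text \<open>With the norm bounded by \<open>M\<close> on the interval, the distance from \<open>y (\<theta> k)\<close> grows at speed at most
  \<open>k1 * M + k2 * norm1 (y (\<theta> k))\<close> and by at most \<open>\<l> * M\<close> at each impulse.\<close>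

lemma variation_between_switches:
  assumes start: "beta \<theta> t0 \<le> \<theta> k" and t: "\<theta> k \<le> t" "t < \<theta> (Suc k)"
  shows "norm1 (y t - y (\<theta> k)) \<le>
    (k2 * \<theta>bar + (k1 * \<theta>bar + \<l> * p) * (1 + k2 * \<theta>bar) * (1 + \<l>) ^ p * exp (k1 * \<theta>bar)) * norm1 (y (\<theta> k))"
proof -
  let ?v = "norm1 (y (\<theta> k))"
  define M where "M = (1 + k2 * \<theta>bar) * (1 + \<l>) ^ p * exp (k1 * \<theta>bar) * ?v"
  have len: "t - \<theta> k \<le> \<theta>bar" using t theta_gap[of k] by linarith
  have M: "norm1 (y x) \<le> M" if "\<theta> k \<le> x" "x < \<theta> (Suc k)" for x
    unfolding M_def using start that by (rule growth_between_switches)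
  have "M \<ge> 0" using M[of "\<theta> k"] t norm1_nonneg[of "y (\<theta> k)"] by linarith
  have "norm1 (y t - y (\<theta> k)) \<le>
      1 ^ p * (norm1 (y (\<theta> k) - y (\<theta> k)) + (k1 * M + k2 * ?v) * (t - \<theta> k) + p * (\<l> * M))"
  proof (rule impulsive_growth[OF t(1) finite_impulses card_impulses_le[OF t(2)]])
    fix x assume x: "\<theta> k < x" "x \<le> t" "x \<in> range \<tau>"
    obtain l where l: "(y \<longlongrightarrow> l) (at_left x)" "norm1 (y x - l) \<le> \<l> * norm1 l"
      using jump_le[of x] x start by (metis le_less_trans)
    have "\<forall>\<^sub>F z in at_left x. norm1 (y z) \<le> M"
      using eventually_at_left_real[OF x(1)] by eventually_elim (use M x t in auto)
    then have "norm1 l \<le> M" using tendsto_upperbound[OF tendsto_norm1[OF l(1)]] by simp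
    then have "norm1 (y x - l) \<le> \<l> * M" using l(2) mult_left_mono[OF _ l_nonneg] by fastforce
    then have "norm1 (y x - y (\<theta> k)) \<le> 1 * norm1 (l - y (\<theta> k)) + \<l> * M"
      using norm1_triangle[of "y x - l" "l - y (\<theta> k)"] by simp
    moreover have "((\<lambda>z. norm1 (y z - y (\<theta> k))) \<longlongrightarrow> norm1 (l - y (\<theta> k))) (at_left x)"
      by (intro tendsto_norm1 tendsto_intros l)
    ultimately show "\<exists>l. ((\<lambda>z. norm1 (y z - y (\<theta> k))) \<longlongrightarrow> l) (at_left x) \<and>
        norm1 (y x - y (\<theta> k)) \<le> 1 * l + \<l> * M" by blast
  next
    fix x assume x: "\<theta> k < x" "x < t" "x \<notin> range \<tau>"
    let ?F = "velocity (y x) (y (beta \<theta> x))"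
    have "beta \<theta> x = \<theta> k" using x t by (intro beta_eq theta) auto
    then have "norm1 ?F \<le> k1 * norm1 (y x) + k2 * ?v" 
      using norm1_velocity_le[of "y x" "y (beta \<theta> x)"] by simp
    also have "\<dots> \<le> k1 * M + k2 * ?v" using M[of x] x t k1(2) by (simp add: mult_left_mono)
    finally have "norm1 ?F \<le> \<dots>" .
    moreover have "((\<lambda>z. y z - y (\<theta> k)) has_vector_derivative ?F) (at_right x)"
      using right_derivative[of x] x start by (auto intro!: derivative_eq_intros)
    then have "upper_right_slope (\<lambda>z. norm1 (y z - y (\<theta> k))) x (norm1 ?F)"
      using upper_right_slope_norm1[of "\<lambda>z. y z - y (\<theta> k)" ?F x "\<lambda>_. 0"] by (simp add: norm1_def)
    ultimately show "\<exists>D\<le>k1 * M + k2 * ?v. upper_right_slope (\<lambda>z. norm1 (y z - y (\<theta> k))) x D"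
      by blast
  next
    show "0 \<le> norm1 (y (\<theta> k) - y (\<theta> k))" "0 \<le> k1 * M + k2 * ?v" "0 \<le> \<l> * M"
      using k1(2) k2(2) l_nonneg \<open>M \<ge> 0\<close> by (simp_all add: norm1_nonneg)
  qed (use start norm1_right_continuous norm1_continuous_off_impulses in simp_all)
  also have "\<dots> \<le> (k1 * M + k2 * ?v) * \<theta>bar + p * (\<l> * M)"
  proof -
    have "0 \<le> k1 * M + k2 * ?v"
      using k1(2) k2(2) \<open>M \<ge> 0\<close> norm1_nonneg by (intro add_nonneg_nonneg mult_nonneg_nonneg)
    moreover have "norm1 (y (\<theta> k) - y (\<theta> k)) = 0" by (simp add: norm1_def)
    ultimately show ?thesis using mult_left_mono[OF len] by simp
  qed
  also have "\<dots> = k2 * \<theta>bar * ?v + (k1 * \<theta>bar + \<l> * p) * M" by (simp add: algebra_simps)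
  also have "\<dots> = (k2 * \<theta>bar + (k1 * \<theta>bar + \<l> * p) * (1 + k2 * \<theta>bar) * (1 + \<l>) ^ p * exp (k1 * \<theta>bar)) * ?v"
    by (simp add: M_def distrib_right[of "k2 * \<theta>bar"] mult.assoc)
  finally show ?thesis .
qed

text \<open>If the state moves by at most the fraction \<open>\<kappa> < 1\<close> of \<open>y (\<theta> k)\<close> before the next switch, then at
  least the fraction \<open>1 - \<kappa>\<close> of \<open>norm1 (y (\<theta> k))\<close> is still present at time \<open>t\<close>. This bounds the past
  by the present and thereby removes the delay.\<close>

lemma delayed_state_le:
  assumes small: "k2 * \<theta>bar + (k1 * \<theta>bar + \<l> * p) * (1 + k2 * \<theta>bar) * (1 + \<l>) ^ p * exp (k1 * \<theta>bar) < 1"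
      (is "?\<kappa> < 1")
    and t: "t0 \<le> t"
  shows "norm1 (y (beta \<theta> t)) \<le> inverse (1 - ?\<kappa>) * norm1 (y t)"
proof -
  obtain k where k: "\<theta> k \<le> t" "t < \<theta> (Suc k)" "beta \<theta> t = \<theta> k"
    using beta_interval[OF theta(2,3), of t] t t0 theta(1) by auto
  have "beta \<theta> t0 \<le> \<theta> k"
    using beta_mono[OF theta(2,3) _ t] t0 theta(1) k(3) by simp
  then have "norm1 (y t - y (\<theta> k)) \<le> ?\<kappa> * norm1 (y (\<theta> k))"
    using variation_between_switches k by blast
  moreover have "norm1 (y (\<theta> k)) \<le> norm1 (y t) + norm1 (y (\<theta> k) - y t)"
    using norm1_triangle[of "y t" "y (\<theta> k) - y t"] by simp
  moreover have "norm1 (y (\<theta> k) - y t) = norm1 (y t - y (\<theta> k))"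
    by (simp add: norm1_def abs_minus_commute)
  ultimately have "(1 - ?\<kappa>) * norm1 (y (\<theta> k)) \<le> norm1 (y t)"
    unfolding left_diff_distrib by linarith
  then show ?thesis using small k(3) by (simp add: field_simps)
qed

text \<open>Once the delayed state is dominated by the current one, the norm satisfies a linear inequality
  without delay. The factor \<open>1 + \<l>\<close> in front of the exponential accounts for the additional impulse
  in the count \<open>(t - t0) / \<tau>low + 1\<close>.\<close>

lemma exponential_decay:
  assumes delay: "\<And>t. t0 \<le> t \<Longrightarrow> norm1 (y (beta \<theta> t)) \<le> \<Lambda> * norm1 (y t)"
    and t: "t0 \<le> t"
  shows "norm1 (y t) \<le>
    (1 + \<l>) * exp (- (\<gamma> - \<mu> - \<Lambda> * k2 - ln (1 + \<l>) / \<tau>low) * (t - t0)) * norm1 (y t0)"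
proof -
  let ?\<sigma> = "\<gamma> - \<mu> - \<Lambda> * k2"
  let ?n = "card (range \<tau> \<inter> {t0<..t})"
  have start: "beta \<theta> t0 \<le> t0"
    using beta_interval[OF theta(2,3), of t0] t0 theta(1) by metis
  have "norm1 (y t) \<le> exp (- ?\<sigma> * (t - t0)) * (1 + \<l>) ^ ?n * (norm1 (y t0) + 0 * (t - t0))"
  proof (rule impulsive_gronwall[OF t finite_impulses order_refl])
    fix x assume x: "t0 < x" "x < t" "x \<notin> range \<tau>"
    let ?F = "velocity (y x) (y (beta \<theta> x))"
    have "upper_right_slope (\<lambda>t. norm1 (y t)) x
        (\<Sum>i\<in>UNIV. - a i * \<bar>y x $ i\<bar> + \<bar>?F $ i + a i * y x $ i\<bar>)"
      using x start by (intro upper_right_slope_norm1 right_derivative) auto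
    moreover have "(\<Sum>i\<in>UNIV. - a i * \<bar>y x $ i\<bar> + \<bar>?F $ i + a i * y x $ i\<bar>)
        \<le> - (\<gamma> - \<mu>) * norm1 (y x) + k2 * norm1 (y (beta \<theta> x))"
      by (rule dissipation_le)
    moreover have "k2 * norm1 (y (beta \<theta> x)) \<le> k2 * (\<Lambda> * norm1 (y x))"
      using delay[of x] x k2(2) by (intro mult_left_mono) auto
    then have "- (\<gamma> - \<mu>) * norm1 (y x) + k2 * norm1 (y (beta \<theta> x))
        \<le> - ?\<sigma> * norm1 (y x) + 0 * exp (- ?\<sigma> * (x - t0))"
      by (simp add: algebra_simps)
    ultimately show "\<exists>D\<le>- ?\<sigma> * norm1 (y x) + 0 * exp (- ?\<sigma> * (x - t0)).
        upper_right_slope (\<lambda>t. norm1 (y t)) x D" by (meson order_trans)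
  next
    show "0 \<le> norm1 (y t0)" by (rule norm1_nonneg)
  qed (use start l_nonneg norm1_right_continuous[of _ 0] norm1_continuous_off_impulses[of _ 0]
         norm1_jump_le in simp_all)
  also have "\<dots> \<le> exp (- ?\<sigma> * (t - t0)) * ((1 + \<l>) * exp (ln (1 + \<l>) / \<tau>low * (t - t0)))
      * (norm1 (y t0) + 0 * (t - t0))"
  proof (intro mult_right_mono mult_left_mono)
    have "(1 + \<l>) ^ ?n = exp (ln (1 + \<l>) * ?n)"
      using l_nonneg by (simp add: exp_of_nat2_mult)
    also have "\<dots> \<le> exp (ln (1 + \<l>) * ((t - t0) / \<tau>low + 1))"
      using card_separated_le[OF tau tau_gap t] l_nonneg by (simp add: mult_left_mono)
    also have "ln (1 + \<l>) * ((t - t0) / \<tau>low + 1) = ln (1 + \<l>) + ln (1 + \<l>) / \<tau>low * (t - t0)"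
      by (simp add: distrib_left)
    also have "exp \<dots> = (1 + \<l>) * exp (ln (1 + \<l>) / \<tau>low * (t - t0))"
      using l_nonneg by (simp add: exp_add)
    finally show "(1 + \<l>) ^ ?n \<le> (1 + \<l>) * exp (ln (1 + \<l>) / \<tau>low * (t - t0))" .
  qed (simp_all add: norm1_nonneg)
  also have "\<dots> = (1 + \<l>) * (exp (- ?\<sigma> * (t - t0)) * exp (ln (1 + \<l>) / \<tau>low * (t - t0))) * norm1 (y t0)"
    by (simp add: mult_ac)
  also have "\<dots> = (1 + \<l>) * exp (- (?\<sigma> - ln (1 + \<l>) / \<tau>low) * (t - t0)) * norm1 (y t0)"
    unfolding exp_add[symmetric] by (simp add: algebra_simps)
  finally show ?thesis .
qed

end

lemma globally_asymptotically_stableI: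
  assumes decay: "\<And>t0 t y. t0 \<ge> 0 \<Longrightarrow> y \<in> Sol t0 \<Longrightarrow> t0 \<le> t \<Longrightarrow>
      norm1 (y t) \<le> K * exp (- \<eta> * (t - t0)) * norm1 (y t0)"
    and "K > 0" "\<eta> > 0"
  shows "zero_globally_asymptotically_stable Sol"
  unfolding zero_globally_asymptotically_stable_def
proof (intro allI impI conjI ballI)
  fix t0 \<epsilon> :: real assume t0: "t0 \<ge> 0" and "\<epsilon> > 0"
  have "norm1 (y t) < \<epsilon>" if y: "y \<in> Sol t0" "norm1 (y t0) < \<epsilon> / K" and t: "t0 \<le> t" for y t
  proof -
    have "norm1 (y t) \<le> K * exp (- \<eta> * (t - t0)) * norm1 (y t0)" using decay t0 y(1) t by blast
    also have "\<dots> \<le> K * 1 * norm1 (y t0)"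
      using \<open>K > 0\<close> \<open>\<eta> > 0\<close> t norm1_nonneg by (intro mult_right_mono mult_left_mono) auto
    also have "\<dots> < \<epsilon>" using y(2) \<open>K > 0\<close> by (simp add: field_simps)
    finally show ?thesis .
  qed
  moreover have "\<epsilon> / K > 0" using \<open>\<epsilon> > 0\<close> \<open>K > 0\<close> by simp
  ultimately show "\<exists>\<delta>>0. \<forall>y\<in>Sol t0. norm1 (y t0) < \<delta> \<longrightarrow> (\<forall>t\<ge>t0. norm1 (y t) < \<epsilon>)" by blast
next
  fix t0 :: real and y assume t0: "t0 \<ge> 0" and y: "y \<in> Sol t0"
  have "LIM t at_top. \<eta> * (t - t0) :> at_top"
    using \<open>\<eta> > 0\<close> filterlim_tendsto_add_at_top[OF tendsto_const[of "- t0"] filterlim_ident]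
    by (intro filterlim_tendsto_pos_mult_at_top[OF tendsto_const]) (simp_all add: add.commute)
  then have "((\<lambda>t. exp (- \<eta> * (t - t0))) \<longlongrightarrow> 0) at_top"
    using filterlim_compose[OF exp_at_bot filterlim_compose[OF filterlim_uminus_at_bot_at_top]]
    by fastforce
  then have "((\<lambda>t. K * exp (- \<eta> * (t - t0)) * norm1 (y t0)) \<longlongrightarrow> K * 0 * norm1 (y t0)) at_top"
    by (intro tendsto_intros)
  then have "((\<lambda>t. K * exp (- \<eta> * (t - t0)) * norm1 (y t0)) \<longlongrightarrow> 0) at_top" by simp
  moreover have "\<forall>\<^sub>F t in at_top. norm (norm1 (y t)) \<le> K * exp (- \<eta> * (t - t0)) * norm1 (y t0)"
    using eventually_ge_at_top[of t0]
    by eventually_elim (use decay[OF t0 y] in \<open>simp add: norm1_nonneg\<close>)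
  ultimately show "((\<lambda>t. norm1 (y t)) \<longlongrightarrow> 0) at_top"
    by (rule Lim_null_comparison[rotated])
qed

section \<open>Global asymptotic stability\<close>

theorem theorem3p1:
  fixes \<theta> \<tau> :: "nat \<Rightarrow> real"
    and \<theta>bar \<tau>low :: real
    and p :: nat
    and a d Lf Lg :: "'m::finite \<Rightarrow> real"
    and b c :: "'m \<Rightarrow> 'm \<Rightarrow> real"
    and f g \<phi> \<psi> :: "'m \<Rightarrow> real \<Rightarrow> real"
    and I W :: "'m \<Rightarrow> nat \<Rightarrow> real \<Rightarrow> real"
    and xs :: "real ^ 'm"
    and \<l> k1 k2 \<mu> \<gamma> \<Lambda> :: real
  assumes theta_seq: "\<theta> 0 = 0" "strict_mono \<theta>" "filterlim \<theta> at_top sequentially"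
    and tau_seq: "strict_mono \<tau>" "filterlim \<tau> at_top sequentially"
    and disjoint: "range \<tau> \<inter> range \<theta> = {}"
    and theta_bar: "\<theta>bar > 0" "\<And>k. \<theta> (Suc k) - \<theta> k \<le> \<theta>bar"
    and tau_low: "\<tau>low > 0" "\<And>k. \<tau>low \<le> \<tau> (Suc k) - \<tau> k"
    and p_finite: "finite (range (num_impulses \<theta> \<tau>))"
    and p_def: "p = Max (range (num_impulses \<theta> \<tau>))"
    and a_pos: "\<And>i. a i > 0"
    and k1_def: "k1 = Max (range (\<lambda>i. a i + Lf i * (\<Sum>j\<in>UNIV. \<bar>b j i\<bar>)))"
    and k2_def: "k2 = Max (range (\<lambda>i. Lg i * (\<Sum>j\<in>UNIV. \<bar>c j i\<bar>)))"
    and mu_def: "\<mu> = Max (range (\<lambda>i. Lf i * (\<Sum>j\<in>UNIV. \<bar>b j i\<bar>)))"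
    and gamma_def: "\<gamma> = Min (range a)"
    and lambda_def: "\<Lambda> = inverse (1 - (k2 * \<theta>bar
          + (k1 * \<theta>bar + \<l> * p) * (1 + k2 * \<theta>bar) * (1 + \<l>) ^ p * exp (k1 * \<theta>bar)))"
    and equilibrium: "\<And>i. 0 = - a i * xs $ i + (\<Sum>j\<in>UNIV. b i j * f j (xs $ j))
                              + (\<Sum>j\<in>UNIV. c i j * g j (xs $ j)) + d i"
    and equilibrium_impulse: "\<And>i k. I i k (xs $ i) = 0"
    and phi_def: "\<And>j u. \<phi> j u = f j (u + xs $ j) - f j (xs $ j)"
    and psi_def: "\<And>j u. \<psi> j u = g j (u + xs $ j) - g j (xs $ j)"
    and W_def: "\<And>i k u. W i k u = I i k (u + xs $ i) - I i k (xs $ i)"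
    and i_f: "\<And>j. Lf j > 0" "\<And>j u v. \<bar>f j u - f j v\<bar> \<le> Lf j * \<bar>u - v\<bar>"
    and i_g: "\<And>j. Lg j > 0" "\<And>j u v. \<bar>g j u - g j v\<bar> \<le> Lg j * \<bar>u - v\<bar>"
    and ii: "\<l> > 0" "\<And>i k u v. \<bar>I i k u - I i k v\<bar> \<le> \<l> * \<bar>u - v\<bar>"
    and iii: "((k1 + 2 * k2) * \<theta>bar + \<l> * p) * (1 + \<l>) ^ p * exp (k1 * \<theta>bar) < 1"
    and iv: "k2 * \<theta>bar
          + (k1 * \<theta>bar + \<l> * p) * (1 + k2 * \<theta>bar) * (1 + \<l>) ^ p * exp (k1 * \<theta>bar) < 1"
    and v: "\<gamma> - \<mu> - \<Lambda> * k2 - ln (1 + \<l>) / \<tau>low > 0"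
  shows "zero_globally_asymptotically_stable
           (\<lambda>t0. {y. is_solution \<theta> \<tau> a b c \<phi> \<psi> W t0 y})"
proof -
  obtain i0 :: 'm where True by blast
  have k1_ge: "a i + Lf i * (\<Sum>j\<in>UNIV. \<bar>b j i\<bar>) \<le> k1" for i
    unfolding k1_def by (rule Max_ge) auto
  have k2_ge: "Lg i * (\<Sum>j\<in>UNIV. \<bar>c j i\<bar>) \<le> k2" for i
    unfolding k2_def by (rule Max_ge) auto
  \<comment> \<open>Any single index bounds the two maxima from below by a nonnegative number.\<close>
  have "0 \<le> a i0 + Lf i0 * (\<Sum>j\<in>UNIV. \<bar>b j i0\<bar>)" "0 \<le> Lg i0 * (\<Sum>j\<in>UNIV. \<bar>c j i0\<bar>)"
    using a_pos[of i0] i_f(1)[of i0] i_g(1)[of i0]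
    by (auto intro!: add_nonneg_nonneg mult_nonneg_nonneg sum_nonneg less_imp_le)
  then have nonneg: "0 \<le> k1" "0 \<le> k2" using k1_ge[of i0] k2_ge[of i0] by linarith+
  have network: "impulsive_network \<theta> \<tau> \<theta>bar \<tau>low p a Lf Lg b c \<phi> \<psi> W \<l> k1 k2 \<mu> \<gamma>"
  proof
    show "num_impulses \<theta> \<tau> k \<le> p" for k
      unfolding p_def using p_finite by (rule Max_ge) simp
    show "\<bar>\<phi> j u\<bar> \<le> Lf j * \<bar>u\<bar>" for j u
      using i_f(2)[of j "u + xs $ j" "xs $ j"] by (simp add: phi_def)
    show "\<bar>\<psi> j u\<bar> \<le> Lg j * \<bar>u\<bar>" for j u
      using i_g(2)[of j "u + xs $ j" "xs $ j"] by (simp add: psi_def)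
    show "\<bar>W i k u\<bar> \<le> \<l> * \<bar>u\<bar>" for i k u
      using ii(2)[of i k "u + xs $ i" "xs $ i"] by (simp add: W_def)
    show "Lf i * (\<Sum>j\<in>UNIV. \<bar>b j i\<bar>) \<le> \<mu>" for i
      unfolding mu_def by (rule Max_ge) auto
    show "\<gamma> \<le> a i" for i
      unfolding gamma_def by (rule Min_le) auto
  qed (fact theta_seq theta_bar tau_seq tau_low k1_ge k2_ge nonneg a_pos less_imp_le[OF ii(1)])+
  show ?thesis
  proof (rule globally_asymptotically_stableI)
    fix t0 t and y :: "real \<Rightarrow> real ^ 'm"
    assume y: "t0 \<ge> 0" "y \<in> {y. is_solution \<theta> \<tau> a b c \<phi> \<psi> W t0 y}" and t: "t0 \<le> t"
    interpret impulsive_trajectory \<theta> \<tau> \<theta>bar \<tau>low p a Lf Lg b c \<phi> \<psi> W \<l> k1 k2 \<mu> \<gamma> t0 y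
      using network y by (simp add: impulsive_trajectory_def impulsive_trajectory_axioms_def)
    show "norm1 (y t) \<le>
        (1 + \<l>) * exp (- (\<gamma> - \<mu> - \<Lambda> * k2 - ln (1 + \<l>) / \<tau>low) * (t - t0)) * norm1 (y t0)"
      using delayed_state_le[OF iv] t unfolding lambda_def by (rule exponential_decay)
  qed (use v ii(1) in auto)
qed

end
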